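(* Let $a,b\in\mathbb{R}$, $\lambda>0$, $1<\omega\leq2$. If $4\max(a^2,b^2)<\lambda^2$, then the matrix $$P=\begin{pmatrix}\lambda^2(4a^2-\lambda^2)(4b^2-\lambda^2)&0&0&0\\0&-2\lambda^2(4b^2-\lambda^2)&0&2a(4b^2-\lambda^2)\\0&0&-2\lambda^2(4a^2-\lambda^2)&-2b(4a^2-\lambda^2)\\0&2a(4b^2-\lambda^2)&-2b(4a^2-\lambda^2)&-2a^2-2b^2+\lambda^2\end{pmatrix}$$ symmetrizes the equivalent system of the D2Q4 model, i.e. $P$ is symmetric positive definite and $PA^1$, $PA^2$ are symmetric, where $A^1,A^2$ are the first-order matrices given in the context. Consequently, under this condition, the equivalent system of the D2Q4 model is hyperbolic.
   Context: The equivalent system of the D2Q4 vectorial lattice-Boltzmann model (kinetic velocities $(\pm\lambda,0)$, $(0,\pm\lambda)$, relaxation parameter $\omega$, time step $\Delta t$) for the scalar transport equation $\partial_t w+\partial_1(aw)+\partial_2(bw)=0$, in the unknowns $Y=(w,y_1,y_2,z_3)^{\intercal}$ where $(y_1,y_2,z_3)$ is the flux error, is $$\partial_tY-\frac{\omega(\omega-2)(\omega^2-2\omega+2)}{2\Delta t(\omega-1)^2}\begin{pmatrix}0\\ y_1\\ y_2\\ z_3\end{pmatrix}+A^1\partial_1Y+A^2\partial_2Y=O(\Delta t),$$ $$A^1=\begin{pmatrix}a&2\gamma_1&0&0\\\gamma_1(\lambda^2-2a^2)&-2a\gamma_2&0&\gamma_2\\-2ab\gamma_1&-2b\gamma_2&0&0\\2\lambda^2a\gamma_1&2\lambda^2\gamma_2&0&0\end{pmatrix},\quad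 A^2=\begin{pmatrix}b&0&2\gamma_1&0\\-2ab\gamma_1&0&-2a\gamma_2&0\\\gamma_1(\lambda^2-2b^2)&0&-2b\gamma_2&-\gamma_2\\-2\lambda^2b\gamma_1&0&-2\lambda^2\gamma_2&0\end{pmatrix},$$ with $$\gamma_1=\frac{(\omega-2)^2(\omega^2-2\omega+2)}{16(\omega-1)^2},\qquad\gamma_2=\frac{\omega^4-4\omega^3+6\omega^2-4\omega+2}{4(\omega-1)^2}.$$ Definition: an equivalent system with first-order matrices $A^1,\dots,A^d$ (here $d=2$) is called hyperbolic if and only if there exists a symmetric positive definite matrix $P^0$ such that $P^0A^i$ is symmetric for all $1\leq i\leq d$. Such a matrix is said to symmetrize the system. *)

theory Defs
  imports "HOL-Analysis.Analysis"
begin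

definition symmetric_matrix :: "real^'n^'n \<Rightarrow> bool" where
  "symmetric_matrix M \<longleftrightarrow> transpose M = M"

definition positive_definite :: "real^'n^'n \<Rightarrow> bool" where
  "positive_definite M \<longleftrightarrow> (\<forall>x. x \<noteq> 0 \<longrightarrow> x \<bullet> (M *v x) > 0)"

text \<open>
  An equivalent system
    \<open>\<partial>\<^sub>t Y + S Y + A\<^sup>1 \<partial>\<^sub>1 Y + \<dots> + A\<^sup>d \<partial>\<^sub>d Y = O(\<Delta>t)\<close>
  in \<open>n\<close> unknowns and \<open>d\<close> space dimensions is represented by its coefficients at given parameter
  values: the zeroth-order matrix \<open>S\<close>, on the left-hand side, and the first-order matrices
  \<open>A\<^sup>i\<close>, indexed by the type \<open>'d\<close>. The remainder \<open>O(\<Delta>t)\<close> is not part of the data.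
\<close>

record ('n::finite, 'd::finite) equivalent_system =
  zeroth_order :: "real^'n^'n"
  first_order :: "(real^'n^'n)^'d"

definition symmetrizes :: "real^'n^'n \<Rightarrow> ('n::finite, 'd::finite) equivalent_system \<Rightarrow> bool" where
  "symmetrizes P E \<longleftrightarrow>
     symmetric_matrix P \<and> positive_definite P \<and>
     (\<forall>i. symmetric_matrix (P ** first_order E $ i))"

definition hyperbolic :: "('n::finite, 'd::finite) equivalent_system \<Rightarrow> bool" where
  "hyperbolic E \<longleftrightarrow> (\<exists>P\<^sub>0. symmetrizes P\<^sub>0 E)"

definition gamma1 :: "real \<Rightarrow> real" where
  "gamma1 \<omega> = (\<omega> - 2)^2 * (\<omega>^2 - 2*\<omega> + 2) / (16 * (\<omega> - 1)^2)"

definition gamma2 :: "real \<Rightarrow> real" where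
  "gamma2 \<omega> = (\<omega>^4 - 4*\<omega>^3 + 6*\<omega>^2 - 4*\<omega> + 2) / (4 * (\<omega> - 1)^2)"

definition d2q4_A1 :: "real \<Rightarrow> real \<Rightarrow> real \<Rightarrow> real \<Rightarrow> real^4^4" where
  "d2q4_A1 a b lam \<omega> = vector
    [vector [a, 2 * gamma1 \<omega>, 0, 0],
     vector [gamma1 \<omega> * (lam^2 - 2*a^2), - 2 * a * gamma2 \<omega>, 0, gamma2 \<omega>],
     vector [- 2 * a * b * gamma1 \<omega>, - 2 * b * gamma2 \<omega>, 0, 0],
     vector [2 * lam^2 * a * gamma1 \<omega>, 2 * lam^2 * gamma2 \<omega>, 0, 0]]"

definition d2q4_A2 :: "real \<Rightarrow> real \<Rightarrow> real \<Rightarrow> real \<Rightarrow> real^4^4" where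
  "d2q4_A2 a b lam \<omega> = vector
    [vector [b, 0, 2 * gamma1 \<omega>, 0],
     vector [- 2 * a * b * gamma1 \<omega>, 0, - 2 * a * gamma2 \<omega>, 0],
     vector [gamma1 \<omega> * (lam^2 - 2*b^2), 0, - 2 * b * gamma2 \<omega>, - gamma2 \<omega>],
     vector [- 2 * lam^2 * b * gamma1 \<omega>, 0, - 2 * lam^2 * gamma2 \<omega>, 0]]"

definition d2q4_zeroth :: "real \<Rightarrow> real \<Rightarrow> real^4^4" where
  "d2q4_zeroth \<omega> \<Delta>t =
    (- (\<omega> * (\<omega> - 2) * (\<omega>^2 - 2*\<omega> + 2) / (2 * \<Delta>t * (\<omega> - 1)^2))) *\<^sub>R
    vector
    [vector [0, 0, 0, 0],
     vector [0, 1, 0, 0],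
     vector [0, 0, 1, 0],
     vector [0, 0, 0, 1]]"

text \<open>
  The unknowns are \<open>Y = (w, y\<^sub>1, y\<^sub>2, z\<^sub>3)\<close>, with \<open>(y\<^sub>1, y\<^sub>2, z\<^sub>3)\<close> the flux error, for the transport
  equation \<open>\<partial>\<^sub>t w + \<partial>\<^sub>1 (a w) + \<partial>\<^sub>2 (b w) = 0\<close>, kinetic speed \<open>lam\<close> (velocities \<open>(\<plusminus>lam, 0)\<close> and \<open>(0, \<plusminus>lam)\<close>), relaxation parameter \<open>\<omega>\<close> and time
  step \<open>\<Delta>t\<close>.
\<close>

definition d2q4_equivalent_system ::
  "real \<Rightarrow> real \<Rightarrow> real \<Rightarrow> real \<Rightarrow> real \<Rightarrow> (4, 2) equivalent_system" where
  "d2q4_equivalent_system a b lam \<omega> \<Delta>t =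
    \<lparr> zeroth_order = d2q4_zeroth \<omega> \<Delta>t,
      first_order = vector [d2q4_A1 a b lam \<omega>, d2q4_A2 a b lam \<omega>] \<rparr>"

definition d2q4_P :: "real \<Rightarrow> real \<Rightarrow> real \<Rightarrow> real^4^4" where
  "d2q4_P a b lam = vector
    [vector [lam^2 * (4*a^2 - lam^2) * (4*b^2 - lam^2), 0, 0, 0],
     vector [0, - 2 * lam^2 * (4*b^2 - lam^2), 0, 2 * a * (4*b^2 - lam^2)],
     vector [0, 0, - 2 * lam^2 * (4*a^2 - lam^2), - 2 * b * (4*a^2 - lam^2)],
     vector [0, 2 * a * (4*b^2 - lam^2), - 2 * b * (4*a^2 - lam^2), - 2*a^2 - 2*b^2 + lam^2]]"

end

theory Submission
  imports Defs
begin

lemma vector_4 [simp]: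
  "(vector [w, x, y, z] :: 'a::zero ^ 4) $ 1 = w"
  "(vector [w, x, y, z] :: 'a::zero ^ 4) $ 2 = x"
  "(vector [w, x, y, z] :: 'a::zero ^ 4) $ 3 = y"
  "(vector [w, x, y, z] :: 'a::zero ^ 4) $ 4 = z"
  unfolding vector_def by simp_all

lemma symmetric_matrix_iff: "symmetric_matrix M \<longleftrightarrow> (\<forall>i j. M $ i $ j = M $ j $ i)"
  unfolding symmetric_matrix_def by (auto simp: transpose_def vec_eq_iff)

lemma symmetric_d2q4_P: "symmetric_matrix (d2q4_P a b lam)"
  by (simp add: symmetric_matrix_iff d2q4_P_def forall_4)

text \<open>\<open>gamma1 \<omega>\<close> and \<open>gamma2 \<omega>\<close> stay folded as atoms,
  so comparing opposite entries leaves polynomial identities. The fourth column of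
  \<open>d2q4_P\<close> makes the unwanted entries of the first column cancel.\<close>

lemma symmetric_d2q4_P_A1: "symmetric_matrix (d2q4_P a b lam ** d2q4_A1 a b lam \<omega>)"
  by (simp add: symmetric_matrix_iff d2q4_P_def d2q4_A1_def forall_4
      matrix_matrix_mult_def sum_4) algebra

text \<open>Mirror image of the first direction: exchanging \<open>a\<close> with \<open>b\<close>
  and index 2 with 3, and flipping the sign of the fourth unknown, fixes \<open>d2q4_P\<close> and
  turns \<open>d2q4_A1\<close> into \<open>d2q4_A2\<close>.\<close>

lemma symmetric_d2q4_P_A2: "symmetric_matrix (d2q4_P a b lam ** d2q4_A2 a b lam \<omega>)"
  by (simp add: symmetric_matrix_iff d2q4_P_def d2q4_A2_def forall_4
      matrix_matrix_mult_def sum_4) algebra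

text \<open>Completing the squares in the second and third variables; the remaining coefficient of
  \<open>x\<^sub>4\<^sup>2\<close>, which is the Schur complement, factorises. Both sides are scaled by \<open>lam\<^sup>2\<close> to avoid
  division.\<close>

lemma d2q4_P_quadratic_form:
  fixes a b lam :: real and x :: "real^4"
  defines "p \<equiv> lam^2 - 4 * a^2" and "q \<equiv> lam^2 - 4 * b^2"
  shows "lam^2 * (x \<bullet> (d2q4_P a b lam *v x)) =
    lam^4 * p * q * (x$1)^2 + 2 * q * (lam^2 * x$2 - a * x$4)^2
      + 2 * p * (lam^2 * x$3 + b * x$4)^2 + p * q * (x$4)^2"
  unfolding p_def q_def inner_vec_def d2q4_P_def matrix_vector_mult_def
  by (simp add: sum_4) algebra

text \<open>The two bounds make all four weights of the squares positive, and the squared linear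
  forms are linearly independent because \<open>lam\<close> is nonzero.\<close>

lemma positive_definite_d2q4_P:
  assumes lam: "lam > 0" and "4 * a^2 < lam^2" and "4 * b^2 < lam^2"
  shows "positive_definite (d2q4_P a b lam)"
  unfolding positive_definite_def
proof (intro allI impI)
  fix x :: "real^4"
  assume "x \<noteq> 0"
  define p q where "p = lam^2 - 4 * a^2" and "q = lam^2 - 4 * b^2"
  have pos: "p > 0" "q > 0" "lam^2 > 0"
    using assms by (auto simp: p_def q_def)
  let ?Q = "x \<bullet> (d2q4_P a b lam *v x)"
  have eq: "lam^2 * ?Q =
    lam^4 * p * q * (x$1)^2 + 2 * q * (lam^2 * x$2 - a * x$4)^2
      + 2 * p * (lam^2 * x$3 + b * x$4)^2 + p * q * (x$4)^2"
    unfolding p_def q_def by (rule d2q4_P_quadratic_form)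
  have nonneg: "lam^4 * p * q * (x$1)^2 \<ge> 0" "2 * q * (lam^2 * x$2 - a * x$4)^2 \<ge> 0"
      "2 * p * (lam^2 * x$3 + b * x$4)^2 \<ge> 0" "p * q * (x$4)^2 \<ge> 0"
    using pos by simp_all
  have "lam^2 * ?Q \<noteq> 0"
  proof
    assume "lam^2 * ?Q = 0"
    then have "lam^4 * p * q * (x$1)^2 = 0" "2 * q * (lam^2 * x$2 - a * x$4)^2 = 0"
        "2 * p * (lam^2 * x$3 + b * x$4)^2 = 0" "p * q * (x$4)^2 = 0"
      using eq nonneg by linarith+
    \<comment> \<open>Once \<open>x$4\<close> vanishes, the mixed squares reduce to those of
      \<open>lam^2 * x$2\<close> and \<open>lam^2 * x$3\<close>.\<close>
    then have "x$1 = 0" "x$4 = 0" "x$2 = 0" "x$3 = 0"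
      using pos lam by auto
    with \<open>x \<noteq> 0\<close> show False
      by (simp add: vec_eq_iff forall_4)
  qed
  moreover have "lam^2 * ?Q \<ge> 0"
    using eq nonneg by linarith
  ultimately show "?Q > 0"
    using pos(3) by (simp add: zero_le_mult_iff less_le)
qed

theorem theorem22:
  fixes a b lam \<omega> \<Delta>t :: real
  assumes "lam > 0" and "1 < \<omega>" and "\<omega> \<le> 2" and "\<Delta>t > 0"
    and "4 * max (a^2) (b^2) < lam^2"
  shows "(symmetric_matrix (d2q4_P a b lam) \<and>
          positive_definite (d2q4_P a b lam) \<and>
          symmetric_matrix (d2q4_P a b lam ** d2q4_A1 a b lam \<omega>) \<and>
          symmetric_matrix (d2q4_P a b lam ** d2q4_A2 a b lam \<omega>)) \<and>
         symmetrizes (d2q4_P a b lam) (d2q4_equivalent_system a b lam \<omega> \<Delta>t) \<and>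
         hyperbolic (d2q4_equivalent_system a b lam \<omega> \<Delta>t)"
proof -
  \<comment> \<open>The bound on the maximum splits into one bound per velocity component, that is,
    positivity of the weights \<open>p\<close> and \<open>q\<close>.\<close>
  have "4 * a^2 < lam^2" "4 * b^2 < lam^2"
    using assms(5) by linarith+
  with assms(1) have pd: "positive_definite (d2q4_P a b lam)"
    by (rule positive_definite_d2q4_P)
  then have "symmetrizes (d2q4_P a b lam) (d2q4_equivalent_system a b lam \<omega> \<Delta>t)"
    by (simp add: symmetrizes_def d2q4_equivalent_system_def forall_2
        symmetric_d2q4_P symmetric_d2q4_P_A1 symmetric_d2q4_P_A2)
  with pd show ?thesis
    unfolding hyperbolic_def
    using symmetric_d2q4_P symmetric_d2q4_P_A1 symmetric_d2q4_P_A2 by blast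
qed

end
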